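(* Let $G$ be a left-orderable group and let $H$ be a locally nilpotent subgroup of $G$. Then there is a left-invariant total order on $G$ such that the restriction of the order to $H$ is bi-invariant.
   Context: A partial order on a group $G$ is a transitive, irreflexive binary relation $\prec$ on $G$; it is a total order if for all $x \neq y$ in $G$ either $x \prec y$ or $y \prec x$. An order $\prec$ on $G$ is left-invariant if $x \prec y$ implies $gx \prec gy$ for all $x,y,g \in G$; it is bi-invariant if $x \prec y$ implies both $gx \prec gy$ and $xg \prec yg$ for all $x,y,g \in G$. $G$ is left-orderable if there exists a left-invariant total order on $G$. A group is locally nilpotent if every finitely generated subgroup of it is nilpotent. The restriction of an order on $G$ to $H$ being bi-invariant means bi-invariant as an order on the group $H$ (i.e. with $x,y,g \in H$). *)

theory Defs
  imports "HOL-Algebra.Generated_Groups"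
begin

text \<open>
  Orders on a group are strict and are represented by binary predicates on the underlying type.
  All conditions below are relativised to the carrier, so the values of the predicate outside the
  carrier are irrelevant, and the restriction of an order to a subgroup \<open>H\<close> is the same
  predicate, regarded as an order on the group \<open>G\<lparr>carrier := H\<rparr>\<close>.
\<close>

definition group_partial_order :: "('a, 'b) monoid_scheme \<Rightarrow> ('a \<Rightarrow> 'a \<Rightarrow> bool) \<Rightarrow> bool" where
  "group_partial_order G R \<longleftrightarrow> transp_on (carrier G) R \<and> irreflp_on (carrier G) R"

definition group_total_order :: "('a, 'b) monoid_scheme \<Rightarrow> ('a \<Rightarrow> 'a \<Rightarrow> bool) \<Rightarrow> bool" where
  "group_total_order G R \<longleftrightarrow> group_partial_order G R \<and> totalp_on (carrier G) R"

definition left_invariant :: "('a, 'b) monoid_scheme \<Rightarrow> ('a \<Rightarrow> 'a \<Rightarrow> bool) \<Rightarrow> bool" where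
  "left_invariant G R \<longleftrightarrow>
     (\<forall>x\<in>carrier G. \<forall>y\<in>carrier G. \<forall>g\<in>carrier G.
        R x y \<longrightarrow> R (g \<otimes>\<^bsub>G\<^esub> x) (g \<otimes>\<^bsub>G\<^esub> y))"

definition bi_invariant :: "('a, 'b) monoid_scheme \<Rightarrow> ('a \<Rightarrow> 'a \<Rightarrow> bool) \<Rightarrow> bool" where
  "bi_invariant G R \<longleftrightarrow>
     (\<forall>x\<in>carrier G. \<forall>y\<in>carrier G. \<forall>g\<in>carrier G.
        R x y \<longrightarrow> R (g \<otimes>\<^bsub>G\<^esub> x) (g \<otimes>\<^bsub>G\<^esub> y) \<and> R (x \<otimes>\<^bsub>G\<^esub> g) (y \<otimes>\<^bsub>G\<^esub> g))"

definition left_orderable :: "('a, 'b) monoid_scheme \<Rightarrow> bool" where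
  "left_orderable G \<longleftrightarrow> (\<exists>R. group_total_order G R \<and> left_invariant G R)"

text \<open>Commutators follow the convention of \<^const>\<open>derived\<close>; the indexing starts with the whole
  group at \<open>0\<close>.\<close>

primrec lower_central_series :: "('a, 'b) monoid_scheme \<Rightarrow> nat \<Rightarrow> 'a set" where
  "lower_central_series G 0 = carrier G"
| "lower_central_series G (Suc n) =
     generate G {x \<otimes>\<^bsub>G\<^esub> g \<otimes>\<^bsub>G\<^esub> inv\<^bsub>G\<^esub> x \<otimes>\<^bsub>G\<^esub> inv\<^bsub>G\<^esub> g | x g.
                   x \<in> lower_central_series G n \<and> g \<in> carrier G}"

definition nilpotent_group :: "('a, 'b) monoid_scheme \<Rightarrow> bool" where
  "nilpotent_group G \<longleftrightarrow> group G \<and> (\<exists>n. lower_central_series G n = {\<one>\<^bsub>G\<^esub>})"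

definition locally_nilpotent_group :: "('a, 'b) monoid_scheme \<Rightarrow> bool" where
  "locally_nilpotent_group G \<longleftrightarrow>
     group G \<and>
     (\<forall>S. finite S \<and> S \<subseteq> carrier G \<longrightarrow> nilpotent_group (subgroup_generated G S))"

end

theory Submission
  imports Defs "HOL-Algebra.Elementary_Groups" "HOL-Analysis.Function_Topology"
begin

text \<open>
  Left orders are encoded by positive cones \<open>P\<close>, and the cones of \<open>G\<close> form a closed subset of the
  compact space \<open>2\<^sup>G\<close>. Hence it is enough to meet finitely many of the conditions
  \<open>x \<in> P \<longleftrightarrow> h x h\<inverse> \<in> P\<close> with \<open>x, h \<in> H\<close> at a time, and \<open>H\<close> may be
  replaced by a nilpotent subgroup \<open>K\<close>.

  For \<open>h \<in> K\<close> and \<open>x\<close> in the \<open>i\<close>-th term of the lower central series put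
  \<open>x\<^sub>n = h\<^sup>n x h\<^sup>-\<^sup>n\<close> and \<open>y = x\<inverse> h x h\<inverse>\<close>. Then \<open>x\<^sub>n\<^sub>+\<^sub>1 = x\<^sub>n y\<^sub>n\<close>, where \<open>y\<close> lies in the next
  term of the series. By induction the sign of \<open>y\<^sub>n\<close> is eventually constant, so \<open>x\<^sub>n\<close> is eventually
  monotone, so the sign of \<open>x\<^sub>n\<close> is eventually constant. Consequently the cones \<open>h\<^sup>-\<^sup>n P h\<^sup>n\<close> have a
  limit point whose restriction to \<open>K\<close> is invariant under \<open>h\<close>. Going up the lower central series,
  one adds such elements \<open>h\<close> one at a time; those already treated remain stabilisers, because
  their commutators with \<open>h\<close> lie in the preceding stage.
\<close>

text \<open>Predicates rather than sets, so that cones are points of the product space of functions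
  into \<open>bool\<close>. That \<open>x\<close> and \<open>inv x\<close> are never both positive
  follows from closure under products and \<open>\<not> P \<one>\<close>.\<close>

definition positive_cone :: "('a, 'b) monoid_scheme \<Rightarrow> ('a \<Rightarrow> bool) \<Rightarrow> bool" where
  "positive_cone G P \<longleftrightarrow>
     (\<forall>x\<in>carrier G. \<forall>y\<in>carrier G. P x \<longrightarrow> P y \<longrightarrow> P (x \<otimes>\<^bsub>G\<^esub> y)) \<and>
     \<not> P \<one>\<^bsub>G\<^esub> \<and>
     (\<forall>x\<in>carrier G. x \<noteq> \<one>\<^bsub>G\<^esub> \<longrightarrow> P x \<or> P (inv\<^bsub>G\<^esub> x))"

definition conjugate :: "('a, 'b) monoid_scheme \<Rightarrow> 'a \<Rightarrow> 'a \<Rightarrow> 'a" where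
  "conjugate G g x = g \<otimes>\<^bsub>G\<^esub> x \<otimes>\<^bsub>G\<^esub> inv\<^bsub>G\<^esub> g"

definition cone_stabilizer ::
    "('a, 'b) monoid_scheme \<Rightarrow> 'a set \<Rightarrow> ('a \<Rightarrow> bool) \<Rightarrow> 'a set" where
  "cone_stabilizer G K P = {s \<in> K. \<forall>x\<in>K. P (conjugate G s x) = P x}"

section \<open>Compactness of the space of positive cones\<close>

text \<open>Tychonoff's theorem, as \<open>bool\<close> is finite.\<close>

lemma compact_UNIV_predicates: "compact (UNIV :: ('a \<Rightarrow> bool) set)"
proof -
  have "compact_space (euclidean :: bool topology)"
    by (simp add: compact_space_def finite_imp_compact)
  then have "compact_space (product_topology (\<lambda>_::'a. euclidean :: bool topology) UNIV)"
    by (simp add: compact_space_product_topology)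
  then show ?thesis
    by (simp add: euclidean_product_topology compact_space_def)
qed

lemma continuous_on_eval: "continuous_on UNIV (\<lambda>f :: 'a \<Rightarrow> bool. f a)"
  by (rule continuous_on_product_coordinates)

lemma open_Collect_eval: "open {f :: 'a \<Rightarrow> bool. f a}"
proof -
  have "open ((\<lambda>f :: 'a \<Rightarrow> bool. f a) -` {True})"
    by (rule open_vimage[OF open_discrete continuous_on_eval])
  then show ?thesis by (simp add: vimage_def)
qed

lemma closed_Collect_eval: "closed {f :: 'a \<Rightarrow> bool. f a}"
proof -
  have "closed ((\<lambda>f :: 'a \<Rightarrow> bool. f a) -` {True})"
    by (intro closed_vimage continuous_on_eval) auto
  then show ?thesis by (simp add: vimage_def)
qed

text \<open>For fixed \<open>x\<close> and \<open>y\<close> each axiom is a Boolean combination of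
  evaluations, which are clopen conditions; intersecting over all \<open>x\<close> and
  \<open>y\<close> keeps closedness.\<close>

lemma closed_positive_cones: "closed {P. positive_cone G P}"
  unfolding positive_cone_def Ball_def
  by (intro closed_Collect_conj closed_Collect_all closed_Collect_imp closed_Collect_disj
      closed_Collect_neg open_Collect_eval closed_Collect_eval open_Collect_const closed_Collect_const)

text \<open>Finite intersection property: each equation \<open>P a = P b\<close> cuts out a closed
  set. This takes the place of choosing limit points below.\<close>

lemma positive_cone_compactness:
  assumes "\<And>E. finite E \<Longrightarrow> E \<subseteq> D \<Longrightarrow> \<exists>P. positive_cone G P \<and> (\<forall>(a, b)\<in>E. P a = P b)"
  shows "\<exists>P. positive_cone G P \<and> (\<forall>(a, b)\<in>D. P a = P b)"
proof -
  define C where "C = (\<lambda>(a, b). {P :: 'a \<Rightarrow> bool. P a = P b})"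
  have "compact {P. positive_cone G P}"
    using compact_Int_closed[OF compact_UNIV_predicates closed_positive_cones] by simp
  moreover have "closed (C d)" for d
    by (cases d) (simp add: C_def closed_Collect_eq continuous_on_eval)
  moreover have "{P. positive_cone G P} \<inter> (\<Inter>d\<in>E. C d) \<noteq> {}" if E: "finite E" "E \<subseteq> D" for E
  proof -
    obtain P where "positive_cone G P" "\<forall>(a, b)\<in>E. P a = P b"
      using assms[OF E] by blast
    then have "P \<in> {P. positive_cone G P} \<inter> (\<Inter>d\<in>E. C d)"
      by (auto simp: C_def)
    then show ?thesis by blast
  qed
  ultimately have "{P. positive_cone G P} \<inter> (\<Inter>d\<in>D. C d) \<noteq> {}"
    by (rule compact_imp_fip_image)
  then obtain P where "P \<in> {P. positive_cone G P} \<inter> (\<Inter>d\<in>D. C d)" by blast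
  then have "positive_cone G P \<and> (\<forall>(a, b)\<in>D. P a = P b)"
    by (auto simp: C_def)
  then show ?thesis by blast
qed

section \<open>Conjugation\<close>

context group
begin

lemma conjugate_closed [simp]:
  "g \<in> carrier G \<Longrightarrow> x \<in> carrier G \<Longrightarrow> conjugate G g x \<in> carrier G"
  by (simp add: conjugate_def)

lemma conjugate_one_right [simp]: "g \<in> carrier G \<Longrightarrow> conjugate G g \<one> = \<one>"
  by (simp add: conjugate_def)

lemma conjugate_one_left [simp]: "x \<in> carrier G \<Longrightarrow> conjugate G \<one> x = x"
  by (simp add: conjugate_def)

lemma conjugate_mult_right:
  assumes "g \<in> carrier G" "x \<in> carrier G" "y \<in> carrier G"
  shows "conjugate G g (x \<otimes> y) = conjugate G g x \<otimes> conjugate G g y"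
  using assms by (simp add: conjugate_def m_assoc inv_solve_left)

lemma conjugate_mult_left:
  assumes "g \<in> carrier G" "h \<in> carrier G" "x \<in> carrier G"
  shows "conjugate G (g \<otimes> h) x = conjugate G g (conjugate G h x)"
  using assms by (simp add: conjugate_def m_assoc inv_mult_group)

lemma conjugate_inv:
  assumes "g \<in> carrier G" "x \<in> carrier G"
  shows "conjugate G g (inv x) = inv (conjugate G g x)"
  using assms by (simp add: conjugate_def m_assoc inv_mult_group)

lemma conjugate_eq_one_iff:
  assumes "g \<in> carrier G" "x \<in> carrier G"
  shows "conjugate G g x = \<one> \<longleftrightarrow> x = \<one>"
proof
  assume "conjugate G g x = \<one>"
  then have "conjugate G (inv g) (conjugate G g x) = \<one>"
    using assms by simp
  then show "x = \<one>"
    using assms by (simp flip: conjugate_mult_left)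
qed (use assms in simp)

text \<open>Moves \<open>g\<close> past \<open>s\<close> at the cost of conjugating
  \<open>s\<close>; this is how invariance under \<open>s\<close> is tested on a conjugated
  cone.\<close>

lemma conjugate_conjugate:
  assumes "g \<in> carrier G" "s \<in> carrier G" "x \<in> carrier G"
  shows "conjugate G g (conjugate G s x) = conjugate G (conjugate G g s) (conjugate G g x)"
proof -
  have "conjugate G g s \<otimes> g = g \<otimes> s"
    using assms by (simp add: conjugate_def m_assoc)
  then show ?thesis
    using assms by (simp flip: conjugate_mult_left)
qed

lemma conjugate_in_subgroup:
  "subgroup K G \<Longrightarrow> g \<in> K \<Longrightarrow> x \<in> K \<Longrightarrow> conjugate G g x \<in> K"
  by (simp add: conjugate_def subgroup.m_closed subgroup.m_inv_closed)

text \<open>Conjugation is an automorphism of \<open>G\<close>, and cones pull back along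
  automorphisms.\<close>

lemma positive_cone_conjugate:
  assumes "positive_cone G P" "g \<in> carrier G"
  shows "positive_cone G (\<lambda>x. P (conjugate G g x))"
  using assms unfolding positive_cone_def
  by (auto simp: conjugate_mult_right conjugate_inv conjugate_eq_one_iff)

lemma cone_stabilizer_mult:
  assumes "subgroup K G" "s \<in> cone_stabilizer G K P" "t \<in> cone_stabilizer G K P"
  shows "s \<otimes> t \<in> cone_stabilizer G K P"
proof -
  have K: "s \<in> K" "t \<in> K" using assms by (auto simp: cone_stabilizer_def)
  have "P (conjugate G (s \<otimes> t) x) = P x" if "x \<in> K" for x
  proof -
    have "conjugate G (s \<otimes> t) x = conjugate G s (conjugate G t x)"
      using K that assms(1) by (simp add: conjugate_mult_left subgroup.mem_carrier)
    then show ?thesis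
      using assms K that by (simp add: cone_stabilizer_def conjugate_in_subgroup)
  qed
  then show ?thesis
    using K assms(1) by (simp add: cone_stabilizer_def subgroup.m_closed)
qed

lemma subgroup_nat_pow:
  assumes "subgroup K G" "h \<in> K"
  shows "h [^] (n::nat) \<in> K"
  by (induction n) (use assms in \<open>auto intro: subgroup.m_closed subgroup.one_closed\<close>)

section \<open>Central filtrations\<close>

text \<open>The induction descends from \<open>c\<close>, where only \<open>\<one>\<close> is left.
  Once the sign of \<open>v n\<close> has settled, the sign of \<open>u n\<close> can switch in one
  direction only, hence at most once.\<close>

lemma conjugate_sign_eventually_constant:
  fixes L :: "nat \<Rightarrow> 'a set"
  assumes cone: "positive_cone G P" and K: "subgroup K G"
    and L: "\<And>i. subgroup (L i) G" "\<And>i. L i \<subseteq> K"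
    and comm: "\<And>i x g. x \<in> L i \<Longrightarrow> g \<in> K \<Longrightarrow> x \<otimes> g \<otimes> inv x \<otimes> inv g \<in> L (Suc i)"
    and trivial: "L c = {\<one>}"
    and h: "h \<in> K" and "i \<le> c" and "x \<in> L i"
  shows "\<exists>N. \<forall>n\<ge>N. P (conjugate G (h [^] n) x) = P (conjugate G (h [^] Suc n) x)"
  using \<open>i \<le> c\<close> \<open>x \<in> L i\<close>
proof (induction i arbitrary: x rule: inc_induct)
  case base
  have "h \<in> carrier G" using h K by (simp add: subgroup.mem_carrier)
  moreover have "x = \<one>" using base trivial by simp
  ultimately show ?case by (simp del: nat_pow_Suc)
next
  case (step i)
  have hc: "h \<in> carrier G" using h K by (simp add: subgroup.mem_carrier)
  have xc: "x \<in> carrier G" using step.prems L(1) by (metis subgroup.mem_carrier)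
  define y where "y = inv x \<otimes> h \<otimes> x \<otimes> inv h"
  \<comment> \<open>\<open>y\<close> is the commutator of \<open>inv x\<close> and \<open>h\<close>,
    so \<open>comm\<close> is applied to \<open>inv x\<close>.\<close>
  have "inv x \<in> L i" using step.prems L(1) by (simp add: subgroup.m_inv_closed)
  from comm[OF this h] have "y \<in> L (Suc i)" using xc by (simp add: y_def)
  from step.IH[OF this] obtain N where
    N: "\<And>n. n \<ge> N \<Longrightarrow> P (conjugate G (h [^] n) y) = P (conjugate G (h [^] Suc n) y)"
    by blast
  have yc: "y \<in> carrier G" using hc xc by (simp add: y_def)
  define u where "u n = conjugate G (h [^] n) x" for n :: nat
  define v where "v n = conjugate G (h [^] n) y" for n :: nat
  have uc: "u n \<in> carrier G" and vc: "v n \<in> carrier G" for n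
    using hc xc yc by (simp_all add: u_def v_def)
  have "x \<otimes> y = conjugate G h x"
    using hc xc by (simp add: y_def conjugate_def m_assoc[symmetric])
  then have usuc: "u (Suc n) = u n \<otimes> v n" for n
    using hc xc yc by (simp add: u_def v_def conjugate_mult_left flip: conjugate_mult_right)
  have vconst: "P (v n) = P (v N)" if "n \<ge> N" for n
    using that by (induction n rule: dec_induct) (use N in \<open>auto simp: v_def\<close>)
  have mult: "P (a \<otimes> b)" if "P a" "P b" "a \<in> carrier G" "b \<in> carrier G" for a b
    using that cone by (auto simp: positive_cone_def)
  show ?case
  proof (cases "P (v N)")
    case True
    then have up: "P (u (Suc n))" if "P (u n)" "n \<ge> N" for n
      using that vconst[OF that(2)] mult uc vc by (simp add: usuc)
    show ?thesis
    proof (cases "\<exists>n0\<ge>N. P (u n0)")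
      case True
      then obtain n0 where n0: "n0 \<ge> N" "P (u n0)" by blast
      have "P (u n)" if "n \<ge> n0" for n
        using that by (induction n rule: dec_induct) (use n0 up in auto)
      then show ?thesis unfolding u_def by (metis le_SucI)
    next
      case False
      then show ?thesis unfolding u_def by (metis le_SucI)
    qed
  next
    case False
    \<comment> \<open>Now each \<open>v n\<close> is trivial or negative, so positivity is passed
      backwards through \<open>u n = u (Suc n) \<otimes> inv (v n)\<close>.\<close>
    have down: "P (u n)" if "P (u (Suc n))" "n \<ge> N" for n
    proof (cases "v n = \<one>")
      case True
      then show ?thesis using that uc by (simp add: usuc)
    next
      case False
      then have "P (inv (v n))"
        using \<open>\<not> P (v N)\<close> vconst[OF \<open>n \<ge> N\<close>] cone vc[of n]
        unfolding positive_cone_def by blast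
      then have "P (u (Suc n) \<otimes> inv (v n))"
        using that uc vc mult by simp
      then show ?thesis using uc vc by (simp add: usuc m_assoc)
    qed
    show ?thesis
    proof (cases "\<exists>n0\<ge>N. \<not> P (u n0)")
      case True
      then obtain n0 where n0: "n0 \<ge> N" "\<not> P (u n0)" by blast
      have "\<not> P (u n)" if "n \<ge> n0" for n
        using that by (induction n rule: dec_induct) (use n0 down in auto)
      then show ?thesis unfolding u_def by (metis le_SucI)
    next
      case False
      then show ?thesis unfolding u_def by (metis le_SucI)
    qed
  qed
qed

text \<open>\<open>Q\<close> acts as a limit point of the pullbacks of \<open>P\<close> under
  conjugation by \<open>h [^] n\<close>: each invariance equation in \<open>D\<close> holds for all
  large \<open>n\<close>, so finitely many hold for a common \<open>n\<close>.\<close>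

lemma cone_stabilizer_insert:
  assumes cone: "positive_cone G P" and K: "subgroup K G" and h: "h \<in> K"
    and A: "A \<subseteq> K"
    and stab: "\<And>s n. s \<in> A \<Longrightarrow> conjugate G (h [^] (n::nat)) s \<in> cone_stabilizer G K P"
    and const: "\<And>x. x \<in> K \<Longrightarrow>
      \<exists>N. \<forall>n\<ge>N. P (conjugate G (h [^] n) x) = P (conjugate G (h [^] Suc n) x)"
  shows "\<exists>Q. positive_cone G Q \<and> insert h A \<subseteq> cone_stabilizer G K Q"
proof -
  note Kc = subgroup.mem_carrier[OF K]
  have hn: "h [^] n \<in> K" for n :: nat
    using subgroup_nat_pow[OF K h] .
  define D where "D = {(conjugate G s x, x) | s x. s \<in> insert h A \<and> x \<in> K}"
  have ev: "\<exists>N::nat. \<forall>n\<ge>N. P (conjugate G (h [^] n) (fst d)) = P (conjugate G (h [^] n) (snd d))"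
    if d: "d \<in> D" for d
  proof -
    obtain s x where sx: "d = (conjugate G s x, x)" "s \<in> insert h A" "x \<in> K"
      using d by (auto simp: D_def)
    show ?thesis
    proof (cases "s = h")
      \<comment> \<open>Conjugating \<open>x\<close> by \<open>h\<close> first shifts
        \<open>n\<close> to \<open>Suc n\<close>, which is the situation of
        \<open>const\<close>.\<close>
      case True
      then show ?thesis
        using const[OF sx(3)] h hn Kc sx by (auto simp: conjugate_mult_left)
    next
      case False
      then have s: "s \<in> A" using sx by simp
      have "P (conjugate G (h [^] n) (conjugate G s x)) = P (conjugate G (h [^] n) x)" for n :: nat
      proof -
        have "conjugate G (h [^] n) (conjugate G s x)
            = conjugate G (conjugate G (h [^] n) s) (conjugate G (h [^] n) x)"
          using s sx A Kc hn by (intro conjugate_conjugate) auto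
        then show ?thesis
          using stab[OF s, of n] sx hn K by (simp add: cone_stabilizer_def conjugate_in_subgroup)
      qed
      then show ?thesis using sx by simp
    qed
  qed
  have "\<exists>Q. positive_cone G Q \<and> (\<forall>(a, b)\<in>D. Q a = Q b)"
  proof (rule positive_cone_compactness)
    fix E assume E: "finite E" "E \<subseteq> D"
    have "\<forall>d\<in>E. \<forall>\<^sub>F n in sequentially.
        P (conjugate G (h [^] n) (fst d)) = P (conjugate G (h [^] n) (snd d))"
      using ev E(2) unfolding eventually_sequentially by blast
    then have "\<forall>\<^sub>F n in sequentially. \<forall>d\<in>E.
        P (conjugate G (h [^] n) (fst d)) = P (conjugate G (h [^] n) (snd d))"
      using E(1) by (simp add: eventually_ball_finite)
    then obtain n :: nat where
      n: "\<forall>d\<in>E. P (conjugate G (h [^] n) (fst d)) = P (conjugate G (h [^] n) (snd d))"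
      by (auto simp: eventually_sequentially)
    show "\<exists>Q. positive_cone G Q \<and> (\<forall>(a, b)\<in>E. Q a = Q b)"
      by (rule exI[of _ "\<lambda>x. P (conjugate G (h [^] n) x)"])
        (use n positive_cone_conjugate[OF cone Kc[OF hn[of n]]] in auto)
  qed
  then obtain Q where "positive_cone G Q" "\<forall>(a, b)\<in>D. Q a = Q b" by blast
  then show ?thesis
    using h A by (fastforce simp: D_def cone_stabilizer_def)
qed

text \<open>Finitely many invariance equations involve only finitely many elements of
  \<open>A\<close>.\<close>

lemma ex_cone_stabilizer_superset:
  assumes A: "A \<subseteq> K"
    and fin: "\<And>F. finite F \<Longrightarrow> F \<subseteq> A \<Longrightarrow> \<exists>P. positive_cone G P \<and> F \<subseteq> cone_stabilizer G K P"
  shows "\<exists>P. positive_cone G P \<and> A \<subseteq> cone_stabilizer G K P"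
proof -
  define f where "f = (\<lambda>(s, x). (conjugate G s x, x))"
  have "\<exists>P. positive_cone G P \<and> (\<forall>(a, b)\<in>f ` (A \<times> K). P a = P b)"
  proof (rule positive_cone_compactness)
    fix E assume "finite E" "E \<subseteq> f ` (A \<times> K)"
    then obtain B where B: "finite B" "B \<subseteq> A \<times> K" "E = f ` B"
      by (meson finite_subset_image)
    then obtain P where "positive_cone G P" "fst ` B \<subseteq> cone_stabilizer G K P"
      using fin[of "fst ` B"] by fastforce
    then show "\<exists>P. positive_cone G P \<and> (\<forall>(a, b)\<in>E. P a = P b)"
      using B by (intro exI[of _ P]) (fastforce simp: f_def cone_stabilizer_def)
  qed
  then obtain P where "positive_cone G P" "\<forall>(a, b)\<in>f ` (A \<times> K). P a = P b" by blast
  then show ?thesis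
    using A by (intro exI[of _ P]) (fastforce simp: f_def cone_stabilizer_def)
qed

text \<open>The outer induction climbs from \<open>L c\<close> to \<open>L 0\<close>; the inner one
  adjoins finitely many elements of \<open>L i\<close> to a stabiliser containing
  \<open>L (Suc i)\<close>, and compactness then reaches all of \<open>L i\<close>.\<close>

lemma ex_invariant_cone_central_filtration:
  fixes L :: "nat \<Rightarrow> 'a set"
  assumes cone: "positive_cone G P" and K: "subgroup K G"
    and L: "\<And>i. subgroup (L i) G" "\<And>i. L i \<subseteq> K" "L 0 = K"
    and comm: "\<And>i x g. x \<in> L i \<Longrightarrow> g \<in> K \<Longrightarrow> x \<otimes> g \<otimes> inv x \<otimes> inv g \<in> L (Suc i)"
    and trivial: "L c = {\<one>}"
  shows "\<exists>Q. positive_cone G Q \<and> cone_stabilizer G K Q = K"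
proof -
  note Kc = subgroup.mem_carrier[OF K]
  have "\<exists>Q. positive_cone G Q \<and> L i \<subseteq> cone_stabilizer G K Q" if "i \<le> c" for i
    using that
  proof (induction i rule: inc_induct)
    case base
    have "\<one> \<in> cone_stabilizer G K P"
      using K Kc by (auto simp: cone_stabilizer_def subgroup.one_closed)
    then show ?case using cone trivial by auto
  next
    case (step i)
    have "\<exists>Q. positive_cone G Q \<and> L (Suc i) \<union> F \<subseteq> cone_stabilizer G K Q"
      if "finite F" "F \<subseteq> L i" for F
      using that
    proof (induction F rule: finite_induct)
      case empty
      then show ?case using step.IH by simp
    next
      case (insert h F)
      then obtain Q where Q: "positive_cone G Q" "L (Suc i) \<union> F \<subseteq> cone_stabilizer G K Q"
        by auto
      have h: "h \<in> L i" "h \<in> K" using insert.prems L(2) by auto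
      have sub: "L (Suc i) \<union> F \<subseteq> K" using insert.prems L(2) by blast
      have "conjugate G (h [^] n) s \<in> cone_stabilizer G K Q"
        if s: "s \<in> L (Suc i) \<union> F" for s and n :: nat
      proof -
        define g where "g = h [^] n"
        have gL: "g \<in> L i" using subgroup_nat_pow[OF L(1) h(1)] by (simp add: g_def)
        have sK: "s \<in> K" using s sub by blast
        have gc: "g \<in> carrier G" and sc: "s \<in> carrier G"
          using gL L(2) sK Kc by auto
        \<comment> \<open>The conjugate of \<open>s\<close> is this commutator times
          \<open>s\<close>. As \<open>g\<close> is in \<open>L i\<close>, the commutator is in
          \<open>L (Suc i)\<close> even when \<open>s\<close> comes from \<open>F\<close>.\<close>
        have "g \<otimes> s \<otimes> inv g \<otimes> inv s \<in> cone_stabilizer G K Q"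
          using comm[OF gL sK] Q(2) by blast
        then have "g \<otimes> s \<otimes> inv g \<otimes> inv s \<otimes> s \<in> cone_stabilizer G K Q"
          using cone_stabilizer_mult[OF K] s Q(2) by blast
        then show ?thesis
          using gc sc by (simp add: conjugate_def m_assoc flip: g_def)
      qed
      \<comment> \<open>Sign stability is taken at index 0, where \<open>L 0 = K\<close>, to cover
        every \<open>x\<close> in \<open>K\<close>.\<close>
      moreover have "\<exists>N. \<forall>n\<ge>N. Q (conjugate G (h [^] n) x) = Q (conjugate G (h [^] Suc n) x)"
        if "x \<in> K" for x
        using conjugate_sign_eventually_constant[OF Q(1) K L(1,2) comm trivial h(2), of 0 x]
          that L(3) by auto
      ultimately show ?case
        using cone_stabilizer_insert[OF Q(1) K h(2) sub] by simp
    qed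
    then show ?case
      using ex_cone_stabilizer_superset[OF L(2), of i] by (meson le_sup_iff)
  qed
  from this[of 0] obtain Q where "positive_cone G Q" "K \<subseteq> cone_stabilizer G K Q"
    using L(3) by auto
  then show ?thesis by (auto simp: cone_stabilizer_def)
qed

section \<open>Nilpotent and locally nilpotent subgroups\<close>

lemma lower_central_series_is_subgroup: "subgroup (lower_central_series G n) G"
proof (induction n)
  case 0
  show ?case by (simp add: subgroup_self)
next
  case (Suc n)
  then show ?case
    by (auto intro!: generate_is_subgroup simp: subgroup.mem_carrier)
qed

text \<open>The lower central series of \<open>K\<close> is a filtration of the required kind, the
  commutators being generators of its next term. It is formed inside \<open>K\<close>, so inverses
  have to be matched with those of \<open>G\<close>.\<close>

lemma ex_invariant_cone_nilpotent:
  assumes cone: "positive_cone G P" and K: "subgroup K G"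
    and nil: "nilpotent_group (G\<lparr>carrier := K\<rparr>)"
  shows "\<exists>Q. positive_cone G Q \<and> cone_stabilizer G K Q = K"
proof -
  let ?K = "G\<lparr>carrier := K\<rparr>"
  interpret K: group ?K using K by (rule subgroup_imp_group)
  obtain c where c: "lower_central_series ?K c = {\<one>}"
    using nil by (auto simp: nilpotent_group_def)
  have sub: "subgroup (lower_central_series ?K i) ?K" for i
    by (rule K.lower_central_series_is_subgroup)
  then have LK: "lower_central_series ?K i \<subseteq> K" for i
    using subgroup.subset by fastforce
  show ?thesis
  proof (rule ex_invariant_cone_central_filtration
        [where L = "lower_central_series ?K", OF cone K _ LK _ _ c])
    show "subgroup (lower_central_series ?K i) G" for i
      using incl_subgroup[OF K sub] .
    show "x \<otimes> g \<otimes> inv x \<otimes> inv g \<in> lower_central_series ?K (Suc i)"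
      if "x \<in> lower_central_series ?K i" "g \<in> K" for i x g
    proof -
      have "x \<in> K" using that LK by blast
      then have "inv x = inv\<^bsub>?K\<^esub> x" "inv g = inv\<^bsub>?K\<^esub> g"
        using K that by (simp_all add: m_inv_consistent)
      then show ?thesis using that by (auto intro!: generate.incl)
    qed
  qed simp
qed

lemma ex_invariant_cone_locally_nilpotent:
  assumes cone: "positive_cone G P" and H: "subgroup H G"
    and nil: "locally_nilpotent_group (G\<lparr>carrier := H\<rparr>)"
  shows "\<exists>Q. positive_cone G Q \<and> (\<forall>h\<in>H. \<forall>x\<in>H. Q (conjugate G h x) = Q x)"
proof -
  let ?H = "G\<lparr>carrier := H\<rparr>"
  interpret H: group ?H using H by (rule subgroup_imp_group)
  define f where "f = (\<lambda>(h, x). (conjugate G h x, x))"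
  have "\<exists>Q. positive_cone G Q \<and> (\<forall>(a, b)\<in>f ` (H \<times> H). Q a = Q b)"
  proof (rule positive_cone_compactness)
    fix E assume "finite E" "E \<subseteq> f ` (H \<times> H)"
    then obtain B where B: "finite B" "B \<subseteq> H \<times> H" "E = f ` B"
      by (meson finite_subset_image)
    \<comment> \<open>Both components are collected, because \<open>cone_stabilizer\<close> tests
      only conjugators and arguments in \<open>K\<close>.\<close>
    define S where "S = fst ` B \<union> snd ` B"
    have S: "finite S" "S \<subseteq> H" using B by (auto simp: S_def)
    define K where "K = generate ?H S"
    have KH: "subgroup K ?H" using S H.generate_is_subgroup by (simp add: K_def)
    have K: "subgroup K G" using incl_subgroup[OF H KH] .
    have SK: "S \<subseteq> K" by (auto simp: K_def intro: generate.incl)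
    have "subgroup_generated ?H S = G\<lparr>carrier := K\<rparr>"
      using S by (simp add: subgroup_generated_def K_def Int_absorb1)
    moreover have "nilpotent_group (subgroup_generated ?H S)"
      using nil S by (simp add: locally_nilpotent_group_def)
    ultimately have "nilpotent_group (G\<lparr>carrier := K\<rparr>)" by simp
    then obtain Q where Q: "positive_cone G Q" "cone_stabilizer G K Q = K"
      using ex_invariant_cone_nilpotent[OF cone K] by blast
    have "Q (conjugate G h x) = Q x" if "(h, x) \<in> B" for h x
    proof -
      have "h \<in> S" "x \<in> S" using that by (force simp: S_def)+
      then show ?thesis using SK Q(2) by (auto simp: cone_stabilizer_def)
    qed
    then show "\<exists>Q. positive_cone G Q \<and> (\<forall>(a, b)\<in>E. Q a = Q b)"
      using B Q(1) by (intro exI[of _ Q]) (auto simp: f_def)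
  qed
  then show ?thesis by (auto simp: f_def)
qed

section \<open>Orders and cones\<close>

text \<open>Left translation by \<open>x\<close> gives \<open>\<one> < x < x \<otimes> y\<close> for
  positive \<open>x\<close> and \<open>y\<close>; translation by \<open>inv x\<close> makes the
  inverse of a negative element positive.\<close>

lemma left_order_imp_positive_cone:
  assumes ord: "group_total_order G R" and inv: "left_invariant G R"
  shows "positive_cone G (R \<one>)"
  unfolding positive_cone_def
proof (intro conjI ballI impI)
  note o = ord[unfolded group_total_order_def group_partial_order_def]
  fix x y assume x: "x \<in> carrier G" and y: "y \<in> carrier G"
  assume "R \<one> x" "R \<one> y"
  moreover from this have "R (x \<otimes> \<one>) (x \<otimes> y)"
    using inv x y unfolding left_invariant_def by blast
  ultimately show "R \<one> (x \<otimes> y)"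
    using o x y by (simp, meson m_closed one_closed transp_onD)
next
  show "\<not> R \<one> \<one>"
    using ord by (auto simp: group_total_order_def group_partial_order_def dest: irreflp_onD)
next
  fix x assume x: "x \<in> carrier G" "x \<noteq> \<one>"
  then have "R \<one> x \<or> R x \<one>"
    using ord unfolding group_total_order_def totalp_on_def by (metis one_closed)
  moreover have "R \<one> (inv x)" if "R x \<one>"
  proof -
    have "R (inv x \<otimes> x) (inv x \<otimes> \<one>)"
      using inv x that unfolding left_invariant_def by blast
    then show ?thesis using x by simp
  qed
  ultimately show "R \<one> x \<or> R \<one> (inv x)" by blast
qed

text \<open>A left translation cancels in \<open>inv x \<otimes> y\<close>, and transitivity comes
  from multiplying two such quotients.\<close>

lemma positive_cone_imp_left_order:
  assumes cone: "positive_cone G P"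
  shows "group_total_order G (\<lambda>x y. P (inv x \<otimes> y))"
    and "left_invariant G (\<lambda>x y. P (inv x \<otimes> y))"
proof -
  have "transp_on (carrier G) (\<lambda>x y. P (inv x \<otimes> y))"
  proof (rule transp_onI)
    fix x y z assume c: "x \<in> carrier G" "y \<in> carrier G" "z \<in> carrier G"
      and p: "P (inv x \<otimes> y)" "P (inv y \<otimes> z)"
    have "P ((inv x \<otimes> y) \<otimes> (inv y \<otimes> z))"
      using cone c p by (simp add: positive_cone_def)
    moreover have "(inv x \<otimes> y) \<otimes> (inv y \<otimes> z) = inv x \<otimes> z"
      using c by (metis inv_closed inv_solve_left m_assoc m_closed)
    ultimately show "P (inv x \<otimes> z)" by simp
  qed
  moreover have "irreflp_on (carrier G) (\<lambda>x y. P (inv x \<otimes> y))"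
    using cone by (auto simp: positive_cone_def intro!: irreflp_onI)
  moreover have "totalp_on (carrier G) (\<lambda>x y. P (inv x \<otimes> y))"
  proof (rule totalp_onI)
    fix x y assume c: "x \<in> carrier G" "y \<in> carrier G" "x \<noteq> y"
    then have "inv x \<otimes> y \<noteq> \<one>"
      by (metis inv_equality inv_inv inv_closed)
    moreover have "inv (inv x \<otimes> y) = inv y \<otimes> x"
      using c by (simp add: inv_mult_group)
    ultimately show "P (inv x \<otimes> y) \<or> P (inv y \<otimes> x)"
      using cone c unfolding positive_cone_def by (metis inv_closed m_closed)
  qed
  ultimately show "group_total_order G (\<lambda>x y. P (inv x \<otimes> y))"
    by (simp add: group_total_order_def group_partial_order_def)
  have "inv (g \<otimes> x) \<otimes> (g \<otimes> y) = inv x \<otimes> y"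
    if "x \<in> carrier G" "y \<in> carrier G" "g \<in> carrier G" for x y g
    using that by (metis inv_closed inv_mult_group inv_solve_left m_assoc m_closed)
  then show "left_invariant G (\<lambda>x y. P (inv x \<otimes> y))"
    by (simp add: left_invariant_def)
qed

text \<open>Right translation by \<open>g\<close> replaces \<open>inv x \<otimes> y\<close> by its
  conjugate under \<open>inv g\<close>, whose sign is the same by hypothesis.\<close>

lemma invariant_cone_imp_bi_invariant:
  assumes cone: "positive_cone G P" and H: "subgroup H G"
    and inv: "\<And>h x. h \<in> H \<Longrightarrow> x \<in> H \<Longrightarrow> P (conjugate G h x) = P x"
  shows "bi_invariant (G\<lparr>carrier := H\<rparr>) (\<lambda>x y. P (inv x \<otimes> y))"
proof -
  note Hc = subgroup.mem_carrier[OF H]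
  have "P (inv (x \<otimes> g) \<otimes> (y \<otimes> g))"
    if h: "x \<in> H" "y \<in> H" "g \<in> H" and p: "P (inv x \<otimes> y)" for x y g
  proof -
    have "inv (x \<otimes> g) \<otimes> (y \<otimes> g) = conjugate G (inv g) (inv x \<otimes> y)"
      using h Hc by (simp add: conjugate_def inv_mult_group m_assoc)
    then show ?thesis
      using inv[of "inv g" "inv x \<otimes> y"] h p H
      by (simp add: subgroup.m_inv_closed subgroup.m_closed)
  qed
  moreover have "P (inv (g \<otimes> x) \<otimes> (g \<otimes> y))"
    if "x \<in> H" "y \<in> H" "g \<in> H" "P (inv x \<otimes> y)" for x y g
    using positive_cone_imp_left_order(2)[OF cone] that Hc by (simp add: left_invariant_def)
  ultimately show ?thesis by (simp add: bi_invariant_def)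
qed

end

theorem theorem1p2:
  fixes G :: "('a, 'b) monoid_scheme" and H :: "'a set"
  assumes "group G"
    and "left_orderable G"
    and "subgroup H G"
    and "locally_nilpotent_group (G\<lparr>carrier := H\<rparr>)"
  shows "\<exists>R. group_total_order G R \<and> left_invariant G R \<and> bi_invariant (G\<lparr>carrier := H\<rparr>) R"
proof -
  interpret group G by fact
  obtain R where "group_total_order G R" "left_invariant G R"
    using assms(2) by (auto simp: left_orderable_def)
  then have "positive_cone G (R \<one>\<^bsub>G\<^esub>)" by (rule left_order_imp_positive_cone)
  from ex_invariant_cone_locally_nilpotent[OF this assms(3,4)]
  obtain Q where "positive_cone G Q" "\<forall>h\<in>H. \<forall>x\<in>H. Q (conjugate G h x) = Q x" by blast
  then show ?thesis
    using positive_cone_imp_left_order[of Q] invariant_cone_imp_bi_invariant[of Q H] assms(3)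
    by blast
qed

end
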